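(* Let $G$ be an OD-admissible graph of order $n$ and let $k = \lceil \log_2 n \rceil \ge 3$. Then $\gamma^{\mathrm{OD}}(G) = k$ if and only if $G$ can be obtained (up to isomorphism) from some graph $G^O(k) = (C \cup (V \setminus C), E)$ by removing up to $2^{k-1}-1$ vertices of $V \setminus C$ if $G^O(k)[C]$ has an isolated vertex, and up to $2^{k-1}-2$ vertices of $V \setminus C$ otherwise.
   Context: Graphs are finite, simple and undirected. For a graph $G=(V,E)$ and $v\in V$, $N(v)$ is the open neighborhood and $N[v]=N(v)\cup\{v\}$ the closed neighborhood; $G[C]$ is the subgraph induced by $C$. Open twins are distinct non-adjacent vertices $u,v$ with $N(u)=N(v)$. A set $C\subseteq V$ is dominating if $N[v]\cap C\neq\emptyset$ for all $v\in V$, and open-separating if $N(u)\cap C\neq N(v)\cap C$ for all distinct $u,v\in V$ (the set $N(v)\cap C$ may be empty for at most one vertex). An OD-code is a set that is both open-separating and dominating. A graph is OD-admissible if it has an OD-code; $\gamma^{\mathrm{OD}}(G)$ is the minimum cardinality of an OD-code of $G$. For $k\ge 2$, $G^O(k)$ denotes any graph with vertex set $V$ and a subset $C\subseteq V$ such that $|C|=k$, the induced subgraph $G^O(k)[C]$ has no open twins, and $V\setminus C$ consists of exactly one vertex $v_{C'}$ with $N(v_{C'})\cap C=C'$ for each non-empty subset $C'\subseteq C$ such that there is no vertex $u\in C$ with $N(u)\cap C=C'$; there is no condition on the edges inside $V\setminus C$. *)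

theory Defs
  imports Complex_Main "Graph_Theory.Graph_Theory"
begin

text \<open>
  Finite simple undirected graphs are the members of the locale \<^locale>\<open>graph\<close>: finite,
  loop-free digraphs without parallel arcs whose adjacency relation is symmetric, so that
  an undirected edge is a pair of opposite arcs.
\<close>

definition open_nbhd :: "('a, 'b) pre_digraph \<Rightarrow> 'a \<Rightarrow> 'a set" where
  "open_nbhd G v = {u. v \<rightarrow>\<^bsub>G\<^esub> u}"

definition closed_nbhd :: "('a, 'b) pre_digraph \<Rightarrow> 'a \<Rightarrow> 'a set" where
  "closed_nbhd G v = insert v (open_nbhd G v)"

definition open_twins :: "('a, 'b) pre_digraph \<Rightarrow> 'a \<Rightarrow> 'a \<Rightarrow> bool" where
  "open_twins G u v \<longleftrightarrow>
     u \<in> verts G \<and> v \<in> verts G \<and> u \<noteq> v \<and> \<not> u \<rightarrow>\<^bsub>G\<^esub> v \<and> open_nbhd G u = open_nbhd G v"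

definition has_isolated_vertex :: "('a, 'b) pre_digraph \<Rightarrow> bool" where
  "has_isolated_vertex G \<longleftrightarrow> (\<exists>v \<in> verts G. open_nbhd G v = {})"

definition dominating :: "('a, 'b) pre_digraph \<Rightarrow> 'a set \<Rightarrow> bool" where
  "dominating G C \<longleftrightarrow> C \<subseteq> verts G \<and> (\<forall>v \<in> verts G. closed_nbhd G v \<inter> C \<noteq> {})"

definition open_separating :: "('a, 'b) pre_digraph \<Rightarrow> 'a set \<Rightarrow> bool" where
  "open_separating G C \<longleftrightarrow> C \<subseteq> verts G \<and>
     (\<forall>u \<in> verts G. \<forall>v \<in> verts G. u \<noteq> v \<longrightarrow> open_nbhd G u \<inter> C \<noteq> open_nbhd G v \<inter> C)"

definition OD_code :: "('a, 'b) pre_digraph \<Rightarrow> 'a set \<Rightarrow> bool" where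
  "OD_code G C \<longleftrightarrow> open_separating G C \<and> dominating G C"

definition OD_admissible :: "('a, 'b) pre_digraph \<Rightarrow> bool" where
  "OD_admissible G \<longleftrightarrow> (\<exists>C. OD_code G C)"

text \<open>Only meaningful for OD-admissible graphs.\<close>

definition OD_number :: "('a, 'b) pre_digraph \<Rightarrow> nat" where
  "OD_number G = (LEAST m. \<exists>C. OD_code G C \<and> card C = m)"

text \<open>
  \<open>GO k H C\<close>: the graph \<open>H\<close> together with \<open>C\<close> is one of the graphs $G^O(k)$. The bijection says
  that the vertices outside \<open>C\<close> are exactly one vertex with trace \<open>C'\<close> on \<open>C\<close> for every
  non-empty \<open>C' \<subseteq> C\<close> that is not already the trace of a vertex of \<open>C\<close>; arcs between
  vertices outside \<open>C\<close> are not constrained.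
\<close>

definition GO :: "nat \<Rightarrow> ('a, 'b) pre_digraph \<Rightarrow> 'a set \<Rightarrow> bool" where
  "GO k H C \<longleftrightarrow> 2 \<le> k \<and> graph H \<and> C \<subseteq> verts H \<and> card C = k \<and>
     \<not> (\<exists>u v. open_twins (H \<restriction> C) u v) \<and>
     bij_betw (\<lambda>v. open_nbhd H v \<inter> C) (verts H - C)
       {C'. C' \<subseteq> C \<and> C' \<noteq> {} \<and> \<not> (\<exists>u \<in> C. open_nbhd H u \<inter> C = C')}"

text \<open>
  The ambient graph \<open>H\<close> has to be sought in a type that may be larger than the vertex type
  of \<open>G\<close>; every finite simple graph is isomorphic to one with vertices in \<^typ>\<open>nat\<close> and arcs
  in \<^typ>\<open>nat \<times> nat\<close>, so this choice loses no generality up to isomorphism.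
\<close>

definition obtainable_from_GO :: "nat \<Rightarrow> ('a, 'b) pre_digraph \<Rightarrow> bool" where
  "obtainable_from_GO k G \<longleftrightarrow>
     (\<exists>(H :: (nat, nat \<times> nat) pre_digraph) C R.
        GO k H C \<and> R \<subseteq> verts H - C \<and>
        card R \<le> (if has_isolated_vertex (H \<restriction> C) then 2 ^ (k - 1) - 1 else 2 ^ (k - 1) - 2) \<and>
        digraph_iso G (H \<restriction> (verts H - R)))"

end

theory Submission
  imports Defs
begin

text \<open>
  The traces \<open>N(v) \<inter> C\<close> of the vertices on an open-separating set \<open>C\<close> are distinct subsets of
  \<open>C\<close>, so \<open>n \<le> 2 ^ card C\<close>; hence no OD-code is smaller than \<open>k\<close>, and \<open>C\<close> is a code in every
  graph obtained from $G^O(k)$. Conversely, add to a graph with an OD-code \<open>C\<close> of size \<open>k\<close> one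
  vertex for each non-empty subset of \<open>C\<close> that is not yet a trace. Since \<open>C\<close> dominates, the
  empty trace can only be that of an isolated vertex of the subgraph induced by \<open>C\<close>, and
  \<open>n > 2 ^ (k - 1)\<close> bounds the number of added vertices.
\<close>

section \<open>Traces on a vertex set\<close>

lemma open_nbhd_induce_subgraph:
  assumes "v \<in> S"
  shows "open_nbhd (G \<restriction> S) v = open_nbhd G v \<inter> S"
  using assms by (auto simp: open_nbhd_def arcs_ends_conv image_iff)

lemma open_separating_iff_inj_on:
  "open_separating G C \<longleftrightarrow> C \<subseteq> verts G \<and> inj_on (\<lambda>v. open_nbhd G v \<inter> C) (verts G)"
  by (auto simp: open_separating_def inj_on_def)

text \<open>A vertex of \<open>C\<close> lies in its own closed neighborhood, so domination only
  constrains the vertices outside \<open>C\<close>, where closed and open neighborhood meet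
  \<open>C\<close> in the same set.\<close>

lemma OD_code_iff:
  "OD_code G C \<longleftrightarrow> C \<subseteq> verts G \<and> inj_on (\<lambda>v. open_nbhd G v \<inter> C) (verts G)
     \<and> (\<forall>v \<in> verts G - C. open_nbhd G v \<inter> C \<noteq> {})"
  by (auto simp: OD_code_def open_separating_iff_inj_on dominating_def closed_nbhd_def)

text \<open>Equal traces already force non-adjacency: an arc from \<open>u\<close> to
  \<open>v\<close> in \<open>C\<close> would put \<open>v\<close> into the trace of
  \<open>u\<close>, hence into its own neighborhood, which is a loop.\<close>

lemma no_open_twins_induce_iff:
  assumes "graph G"
  shows "\<not> (\<exists>u v. open_twins (G \<restriction> C) u v) \<longleftrightarrow> inj_on (\<lambda>v. open_nbhd G v \<inter> C) C"
proof -
  interpret graph G by fact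
  have na: "\<not> u \<rightarrow>\<^bsub>G \<restriction> C\<^esub> v"
    if "v \<in> C" "open_nbhd G u \<inter> C = open_nbhd G v \<inter> C" for u v
    using that adj_not_same dominates_induce_subgraphD[of u v G C]
    by (auto simp: open_nbhd_def)
  show ?thesis
    unfolding open_twins_def inj_on_def
    using na by (auto simp: open_nbhd_induce_subgraph)
qed

lemma card_verts_le_of_open_separating:
  assumes "fin_digraph G" "open_separating G C"
  shows "card (verts G) \<le> 2 ^ card C"
proof -
  interpret fin_digraph G by fact
  have "finite C"
    using assms(2) finite_subset[OF _ finite_verts] by (auto simp: open_separating_def)
  moreover have "card (verts G) \<le> card (Pow C)"
    using assms(2) \<open>finite C\<close> by (intro card_inj_on_le) (auto simp: open_separating_iff_inj_on)
  ultimately show ?thesis by (simp add: card_Pow)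
qed

text \<open>Injectivity on the vertices makes images commute with intersections, so every trace is
  carried to the image of a trace. This lets codes pass between \<open>G\<close> and its copies in
  other types.\<close>

lemma OD_code_app_iso:
  assumes hom: "pre_digraph.digraph_isomorphism G hom" and C: "OD_code G C"
  shows "OD_code (app_iso hom G) (iso_verts hom ` C)"
proof -
  let ?f = "iso_verts hom"
  interpret wf_digraph G using hom by (simp add: pre_digraph.digraph_isomorphism_def)
  have inj: "inj_on ?f (verts G)" by (rule digraph_isomorphism_inj_on_verts[OF hom])
  have CV: "C \<subseteq> verts G" using C by (simp add: OD_code_iff)
  have nbhd: "open_nbhd (app_iso hom G) (?f v) = ?f ` open_nbhd G v" if v: "v \<in> verts G" for v
  proof -
    \<comment> \<open>Injectivity holds on \<open>verts G\<close> only; the arc out of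
      \<open>w\<close> certifies that \<open>w\<close> is a vertex.\<close>
    have "?f v = ?f w \<longleftrightarrow> w = v" if "w \<rightarrow>\<^bsub>G\<^esub> u" for u w
      using v adj_in_verts(1)[OF that] inj by (auto dest: inj_onD)
    then show ?thesis
      by (auto simp: open_nbhd_def arcs_ends_app_iso_eq[OF hom])
  qed
  have sub: "open_nbhd G v \<subseteq> verts G" for v
    by (auto simp: open_nbhd_def dest: adj_in_verts)
  have trace: "open_nbhd (app_iso hom G) (?f v) \<inter> ?f ` C = ?f ` (open_nbhd G v \<inter> C)"
    if "v \<in> verts G" for v
    using inj_on_image_Int[OF inj sub CV] by (simp add: nbhd that)
  have eq: "?f ` A = ?f ` B \<longleftrightarrow> A = B" if "A \<subseteq> verts G" "B \<subseteq> verts G" for A B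
    using inj_on_image_eq_iff[OF inj that] .
  have "inj_on (\<lambda>v. open_nbhd (app_iso hom G) v \<inter> ?f ` C) (?f ` verts G)"
  proof (rule inj_onI)
    fix x y assume "x \<in> ?f ` verts G" "y \<in> ?f ` verts G"
      and e: "open_nbhd (app_iso hom G) x \<inter> ?f ` C = open_nbhd (app_iso hom G) y \<inter> ?f ` C"
    then obtain u v where uv: "x = ?f u" "y = ?f v" "u \<in> verts G" "v \<in> verts G" by auto
    with e have "open_nbhd G u \<inter> C = open_nbhd G v \<inter> C"
      using sub by (subst eq[symmetric]) (auto simp: trace)
    with C uv show "x = y" by (auto simp: OD_code_iff dest: inj_onD)
  qed
  moreover have "open_nbhd (app_iso hom G) x \<inter> ?f ` C \<noteq> {}"
    if "x \<in> ?f ` verts G - ?f ` C" for x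
    using that C by (fastforce simp: OD_code_iff trace)
  ultimately show ?thesis using CV by (auto simp: OD_code_iff)
qed

lemma card_iso_verts_image:
  assumes "pre_digraph.digraph_isomorphism G hom" "C \<subseteq> verts G"
  shows "card (iso_verts hom ` C) = card C"
  using assms pre_digraph.digraph_isomorphism_inj_on_verts by (metis card_image inj_on_subset)

text \<open>Traces are distinct inside \<open>C\<close> because there are no open twins, and outside
  \<open>C\<close> by the bijection, whose target avoids the traces of \<open>C\<close> and the
  empty set. Deleting vertices outside \<open>C\<close> changes no trace on
  \<open>C\<close>.\<close>

lemma OD_code_of_GO:
  assumes GO: "GO k H C" and R: "R \<subseteq> verts H - C"
  shows "OD_code (H \<restriction> (verts H - R)) C"
proof -
  let ?t = "\<lambda>v. open_nbhd H v \<inter> C"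
  have CV: "C \<subseteq> verts H" and inC: "inj_on ?t C"
    and bij: "bij_betw ?t (verts H - C) {S. S \<subseteq> C \<and> S \<noteq> {} \<and> \<not> (\<exists>u \<in> C. ?t u = S)}"
    using GO no_open_twins_induce_iff[of H C] by (auto simp: GO_def)
  have im: "?t ` (verts H - C) = {S. S \<subseteq> C \<and> S \<noteq> {} \<and> \<not> (\<exists>u \<in> C. ?t u = S)}"
    using bij by (simp add: bij_betw_def)
  have "inj_on ?t (C \<union> (verts H - C))"
    unfolding inj_on_Un using inC bij im by (auto simp: bij_betw_def)
  then have inj: "inj_on ?t (verts H)" by (rule inj_on_subset) auto
  have tr: "open_nbhd (H \<restriction> (verts H - R)) v \<inter> C = ?t v" if "v \<in> verts H - R" for v
    using that R CV by (auto simp: open_nbhd_induce_subgraph)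
  have ne: "?t v \<noteq> {}" if "v \<in> verts H - C" for v
    using im that by blast
  have "inj_on (\<lambda>v. open_nbhd (H \<restriction> (verts H - R)) v \<inter> C) (verts H - R)"
    by (subst inj_on_cong[OF tr]) (auto intro: inj_on_subset[OF inj])
  moreover have "open_nbhd (H \<restriction> (verts H - R)) v \<inter> C \<noteq> {}" if "v \<in> verts H - R - C" for v
    using tr[of v] ne[of v] that by auto
  ultimately show ?thesis using CV R by (auto simp: OD_code_iff)
qed

section \<open>Completing a graph with an OD-code\<close>

text \<open>With pairs as arcs, an arc is determined by its ends, so parallel arcs cannot
  occur.\<close>

lemma graph_of_sym_irrefl_rel:
  fixes V :: "'a set" and E :: "('a \<times> 'a) set"
  assumes "finite V" "E \<subseteq> V \<times> V" "sym E" "irrefl E"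
  shows "graph \<lparr>verts = V, arcs = E, tail = fst, head = snd\<rparr>"
proof -
  have "finite E" using assms(1,2) finite_subset by blast
  moreover have "(\<lambda>e. (fst e, snd e)) ` E = E" by simp
  ultimately show ?thesis
    using assms
    by unfold_locales (auto simp: symmetric_def arcs_ends_conv irrefl_def arc_to_ends_def)
qed

text \<open>The vertex type of \<open>G\<close> may be finite and leave no room for new vertices, so
  \<open>G\<close> is first copied into a type with a supply of fresh ones.\<close>

lemma graph_iso_to_infinite_type:
  fixes G :: "('a, 'b) pre_digraph"
  assumes "graph G" and inf: "infinite (UNIV :: 'c set)"
  obtains V :: "'c set" and E where
    "graph \<lparr>verts = V, arcs = E, tail = fst, head = snd\<rparr>"
    "digraph_iso G \<lparr>verts = V, arcs = E, tail = fst, head = snd\<rparr>"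
proof -
  interpret graph G by fact
  obtain W :: "'c set" where "finite W" "card W = card (verts G)"
    using infinite_arbitrarily_large[OF inf] by metis
  then obtain f :: "'a \<Rightarrow> 'c" where f: "inj_on f (verts G)"
    using finite_same_card_bij[OF finite_verts] bij_betw_imp_inj_on by metis
  define h :: "'b \<Rightarrow> 'c \<times> 'c" where "h = (\<lambda>e. (f (tail G e), f (head G e)))"
  define hom :: "('a, 'b, 'c, 'c \<times> 'c) digraph_isomorphism"
    where "hom = \<lparr>iso_verts = f, iso_arcs = h, iso_head = snd, iso_tail = fst\<rparr>"
  \<comment> \<open>Renaming an arc to the pair of its renamed ends loses nothing, since
    \<open>G\<close> has no parallel arcs.\<close>
  have "inj_on h (arcs G)"
    by (rule inj_onI, rule no_multi_arcs)
      (auto simp: h_def arc_to_ends_def dest: inj_onD[OF f])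
  then have "digraph_isomorphism hom"
    using f by (auto simp: digraph_isomorphism_def hom_def h_def wf_digraph)
  then have iso: "digraph_iso G \<lparr>verts = f ` verts G, arcs = h ` arcs G, tail = fst, head = snd\<rparr>"
    by (auto simp: digraph_iso_def app_iso_def hom_def)
  have "graph \<lparr>verts = f ` verts G, arcs = h ` arcs G, tail = fst, head = snd\<rparr>"
  proof (rule graph_of_sym_irrefl_rel)
    show "sym (h ` arcs G)"
    proof (rule symI)
      fix x y assume "(x, y) \<in> h ` arcs G"
      then obtain e where e: "e \<in> arcs G" "x = f (tail G e)" "y = f (head G e)"
        by (auto simp: h_def)
      obtain e' where "e' \<in> arcs G" "tail G e' = head G e" "head G e' = tail G e"
        using sym_arcs e(1) unfolding symmetric_conv by metis
      with e show "(y, x) \<in> h ` arcs G" by (force simp: h_def)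
    qed
    show "irrefl (h ` arcs G)"
      by (auto simp: irrefl_def h_def dest!: inj_onD[OF f]) (metis no_loops)
  qed (auto simp: h_def)
  with iso that show thesis by blast
qed

text \<open>After the completion each non-empty subset of \<open>C\<close> is the trace of exactly
  one vertex. The count is stated as an equation, so that a lower bound on \<open>card V\<close>
  turns into an upper bound on \<open>card R\<close>.\<close>

lemma GO_completion:
  fixes V C :: "'a set" and E
  defines "G \<equiv> \<lparr>verts = V, arcs = E, tail = fst, head = snd\<rparr>"
  assumes G: "graph G" and inf: "infinite (UNIV :: 'a set)"
    and C: "OD_code G C" and k: "card C = k" "2 \<le> k"
  obtains H :: "('a, 'a \<times> 'a) pre_digraph" and R where
    "GO k H C" "R \<subseteq> verts H - C" "H \<restriction> (verts H - R) = G"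
    "card V + card R = (if has_isolated_vertex (H \<restriction> C) then 2 ^ k else 2 ^ k - 1)"
proof -
  interpret graph G by fact
  have finV: "finite V" using finite_verts by (simp add: G_def)
  have EV: "E \<subseteq> V \<times> V"
    using tail_in_verts head_in_verts by (force simp: G_def)
  have symE: "sym E" using sym_arcs by (simp add: symmetric_def arcs_ends_conv G_def)
  have irrE: "irrefl E" using no_loops by (fastforce simp: irrefl_def G_def)
  have nbG: "open_nbhd G v = {u. (v, u) \<in> E}" for v
    by (simp add: open_nbhd_def arcs_ends_conv G_def)
  let ?t = "\<lambda>v. open_nbhd G v \<inter> C"
  have CV: "C \<subseteq> V" and inj: "inj_on ?t V" and ne: "\<And>v. v \<in> V - C \<Longrightarrow> ?t v \<noteq> {}"
    using C by (auto simp: OD_code_iff G_def)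
  have finC: "finite C" using CV finV finite_subset by blast
  define M where "M = Pow C - {{}} - ?t ` V"
  have finM: "finite M" using finC by (simp add: M_def)
  have "infinite (UNIV - V)" using inf finV by simp
  then obtain W where W: "W \<subseteq> UNIV - V" "finite W" "card W = card M"
    using infinite_arbitrarily_large by metis
  then obtain g where g: "bij_betw g M W"
    using finite_same_card_bij[OF finM] by metis
  \<comment> \<open>The new vertex \<open>g S\<close> is joined exactly to the members of the
    missing trace \<open>S\<close>. Old vertices gain neighbors only in \<open>W\<close>, which is
    disjoint from \<open>C\<close>, so their traces stay the same.\<close>
  define F where "F = {(g S, c) | S c. S \<in> M \<and> c \<in> S}"
  define H :: "('a, 'a \<times> 'a) pre_digraph"
    where "H = \<lparr>verts = V \<union> W, arcs = E \<union> F \<union> F\<inverse>, tail = fst, head = snd\<rparr>"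
  have gW: "g S \<in> W" if "S \<in> M" for S using g that by (auto simp: bij_betw_def)
  have FW: "F \<subseteq> W \<times> C" using gW by (auto simp: F_def M_def)
  have WV: "W \<inter> V = {}" using W by auto
  have "graph H"
    unfolding H_def
  proof (rule graph_of_sym_irrefl_rel)
    show "sym (E \<union> F \<union> F\<inverse>)" using symE by (auto simp: sym_def)
    show "irrefl (E \<union> F \<union> F\<inverse>)" using irrE FW WV CV by (auto simp: irrefl_def)
  qed (use finV W EV FW CV in auto)
  have nbH: "open_nbhd H v = {u. (v, u) \<in> E \<union> F \<union> F\<inverse>}" for v
    by (simp add: open_nbhd_def arcs_ends_conv H_def)
  have tV: "open_nbhd H v \<inter> C = ?t v" if "v \<in> V" for v
    using that FW WV CV by (auto simp: nbH nbG)
  have tW: "open_nbhd H (g S) \<inter> C = S" if "S \<in> M" for S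
  proof -
    have "g S \<notin> V" using gW that WV by auto
    moreover have "(g S, c) \<in> F \<longleftrightarrow> c \<in> S" for c
      using g that by (auto simp: F_def bij_betw_def dest: inj_onD)
    ultimately show ?thesis using that EV FW CV by (auto simp: nbH M_def)
  qed
  have imW: "W = g ` M" using g by (simp add: bij_betw_def)
  have inC: "inj_on (\<lambda>v. open_nbhd H v \<inter> C) C"
    by (subst inj_on_cong[OF tV]) (use CV inj inj_on_subset in auto)
  have VC: "verts H - C = (V - C) \<union> W" using WV CV by (auto simp: H_def)
  have "bij_betw (\<lambda>v. open_nbhd H v \<inter> C) (V - C) (?t ` (V - C))"
    by (subst bij_betw_cong[OF tV]) (auto simp: bij_betw_def intro: inj_on_subset[OF inj])
  moreover have "bij_betw (\<lambda>v. open_nbhd H v \<inter> C) W M"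
    unfolding imW by (rule bij_betwI'[where Y = M]) (auto simp: tW intro: imageI)
  ultimately have "bij_betw (\<lambda>v. open_nbhd H v \<inter> C) (verts H - C) (?t ` (V - C) \<union> M)"
    unfolding VC by (rule bij_betw_combine) (auto simp: M_def)
  moreover have "?t ` (V - C) \<union> M =
      {S. S \<subseteq> C \<and> S \<noteq> {} \<and> \<not> (\<exists>u \<in> C. open_nbhd H u \<inter> C = S)}" (is "_ = ?N")
  proof -
    have "?t ` C = (\<lambda>v. open_nbhd H v \<inter> C) ` C"
      using tV CV by (intro image_cong) auto
    then have N: "?N = Pow C - {{}} - ?t ` C" by auto
    \<comment> \<open>By injectivity, the traces of vertices outside \<open>C\<close> are those of
      \<open>V\<close> that do not occur on \<open>C\<close>; together with \<open>M\<close> they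
      fill the target set of \<open>GO\<close>.\<close>
    have diff: "?t ` (V - C) = ?t ` V - ?t ` C"
      using inj_on_image_set_diff[OF inj _ CV, of V] by simp
    have "{} \<notin> ?t ` (V - C)" using ne by (force simp: image_iff)
    moreover have "?t ` V \<subseteq> Pow C" by auto
    moreover have "?t ` C \<subseteq> ?t ` V" using CV by (rule image_mono)
    ultimately show ?thesis unfolding N M_def diff by blast
  qed
  ultimately have GO: "GO k H C"
    using \<open>graph H\<close> CV k no_open_twins_induce_iff[OF \<open>graph H\<close>, of C] inC
    by (auto simp: GO_def H_def)
  have "has_isolated_vertex (H \<restriction> C) \<longleftrightarrow> (\<exists>v \<in> C. open_nbhd H v \<inter> C = {})"
    by (simp add: has_isolated_vertex_def open_nbhd_induce_subgraph)
  also have "\<dots> \<longleftrightarrow> (\<exists>v \<in> C. ?t v = {})"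
    using tV CV by (intro bex_cong) auto
  \<comment> \<open>Domination enters here: no vertex outside \<open>C\<close> has an empty
    trace.\<close>
  also have "\<dots> \<longleftrightarrow> (\<exists>v \<in> V. ?t v = {})" using ne CV by blast
  also have "\<dots> \<longleftrightarrow> {} \<in> ?t ` V" by (simp add: image_iff eq_commute)
  finally have iso: "has_isolated_vertex (H \<restriction> C) \<longleftrightarrow> {} \<in> ?t ` V" .
  have sub: "?t ` V \<subseteq> Pow C" by auto
  have "card V + card W = card (?t ` V) + card M"
    using W(3) card_image[OF inj] by simp
  also have "\<dots> = card (?t ` V \<union> M)"
    using finV finM by (intro card_Un_disjoint[symmetric]) (auto simp: M_def)
  also have "?t ` V \<union> M = (if {} \<in> ?t ` V then Pow C else Pow C - {{}})"
    using sub by (auto simp: M_def)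
  also have "card \<dots> = (if {} \<in> ?t ` V then 2 ^ k else 2 ^ k - 1)"
    using finC k by (simp add: card_Pow)
  finally have card: "card V + card W = (if has_isolated_vertex (H \<restriction> C) then 2 ^ k else 2 ^ k - 1)"
    unfolding iso .
  have "verts H - W = V" using WV by (auto simp: H_def)
  \<comment> \<open>Every arc of \<open>F\<close> has an end in \<open>W\<close>, so the restriction
    gives back \<open>G\<close> itself and not just an isomorphic copy.\<close>
  moreover have "H \<restriction> V = G"
    using EV FW WV by (auto simp: induce_subgraph_def H_def G_def)
  ultimately have "H \<restriction> (verts H - W) = G" by simp
  moreover have "W \<subseteq> verts H - C" using VC by auto
  ultimately show thesis using GO card that by blast
qed

section \<open>The OD-number\<close>

lemma OD_number_le: "OD_code G C \<Longrightarrow> OD_number G \<le> card C"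
  unfolding OD_number_def by (rule Least_le) blast

lemma OD_admissible_obtains_minimum_code:
  assumes "OD_admissible G"
  obtains C where "OD_code G C" "card C = OD_number G"
  using assms LeastI_ex[of "\<lambda>m. \<exists>C. OD_code G C \<and> card C = m"]
  unfolding OD_number_def OD_admissible_def by blast

text \<open>The hypothesis \<open>0 < k\<close> rules out \<open>n = 0\<close>, for which \<open>log 2 0 = 0\<close>.\<close>

lemma power_less_of_ceiling_log:
  fixes n k :: nat
  assumes "int k = \<lceil>log 2 (real n)\<rceil>" "0 < k"
  shows "2 ^ (k - 1) < n"
proof -
  have "n \<noteq> 0" using assms by (intro notI) (simp add: log_def)
  have "real (k - 1) < log 2 (real n)"
    using assms(2) ceiling_correct[of "log 2 (real n)"] by (auto simp flip: assms(1))
  with \<open>n \<noteq> 0\<close> have "2 powr real (k - 1) < real n" by (simp add: less_log_iff)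
  then have "real (2 ^ (k - 1)) < real n" by (simp add: powr_realpow)
  then show ?thesis by (simp only: of_nat_less_iff)
qed

theorem theorem4:
  fixes G :: "('a, 'b) pre_digraph" and n k :: nat
  assumes "graph G"
    and "OD_admissible G"
    and "n = card (verts G)"
    and "int k = \<lceil>log 2 (real n)\<rceil>"
    and "k \<ge> 3"
  shows "OD_number G = k \<longleftrightarrow> obtainable_from_GO k G"
proof -
  interpret graph G by fact
  have low: "2 ^ (k - 1) < n" using power_less_of_ceiling_log assms(4,5) by simp
  obtain C where C: "OD_code G C" "card C = OD_number G"
    using OD_admissible_obtains_minimum_code[OF assms(2)] .
  \<comment> \<open>Comparing exponents in \<open>2 ^ (k - 1) < n\<close> and this bound gives
    \<open>k \<le> OD_number G\<close>, which leaves only the upper bound for the backward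
    direction.\<close>
  have "card (verts G) \<le> 2 ^ card C"
    using card_verts_le_of_open_separating[OF fin_digraph] C(1) by (simp add: OD_code_def)
  with low assms(3) have "2 ^ (k - 1) < (2 :: nat) ^ card C" by (simp only: less_le_trans)
  then have "k - 1 < card C" by (rule power_less_imp_less_exp[rotated]) simp
  then have k_le: "k \<le> OD_number G" using C(2) by simp
  show ?thesis
  proof
    assume num: "OD_number G = k"
    obtain V :: "nat set" and E where
      gr: "graph \<lparr>verts = V, arcs = E, tail = fst, head = snd\<rparr>" (is "graph ?G'") and
      iso: "digraph_iso G \<lparr>verts = V, arcs = E, tail = fst, head = snd\<rparr>"
      using graph_iso_to_infinite_type[OF assms(1) infinite_UNIV_nat] by blast
    obtain hom where hom: "digraph_isomorphism hom" "?G' = app_iso hom G"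
      using iso by (auto simp: digraph_iso_def)
    have code: "OD_code ?G' (iso_verts hom ` C)"
      using OD_code_app_iso[OF hom(1) C(1)] hom(2) by simp
    have "card (iso_verts hom ` C) = k"
      using card_iso_verts_image[OF hom(1)] C num by (simp add: OD_code_iff)
    then obtain H :: "(nat, nat \<times> nat) pre_digraph" and R where
      H: "GO k H (iso_verts hom ` C)" "R \<subseteq> verts H - iso_verts hom ` C"
        "H \<restriction> (verts H - R) = ?G'" and
      card: "card V + card R =
        (if has_isolated_vertex (H \<restriction> (iso_verts hom ` C)) then 2 ^ k else 2 ^ k - 1)"
      using GO_completion[OF gr infinite_UNIV_nat code] assms(5) by auto
    have "V = iso_verts hom ` verts G"
      using arg_cong[OF hom(2), of verts] by simp
    then have "card V = n"
      using card_iso_verts_image[OF hom(1)] assms(3) by simp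
    \<comment> \<open>Subtracting \<open>n \<ge> 2 ^ (k - 1) + 1\<close> from \<open>2 ^ k\<close>
      or \<open>2 ^ k - 1\<close> yields the two bounds on \<open>card R\<close>.\<close>
    moreover have "(2 :: nat) ^ k = 2 * 2 ^ (k - 1)"
      using assms(5) by (simp add: power_eq_if)
    ultimately have "card R \<le> (if has_isolated_vertex (H \<restriction> (iso_verts hom ` C))
        then 2 ^ (k - 1) - 1 else 2 ^ (k - 1) - 2)"
      using card low by (auto split: if_splits)
    with H iso show "obtainable_from_GO k G"
      unfolding obtainable_from_GO_def by metis
  next
    assume "obtainable_from_GO k G"
    then obtain H :: "(nat, nat \<times> nat) pre_digraph" and D R where
      H: "GO k H D" "R \<subseteq> verts H - D" and iso: "digraph_iso G (H \<restriction> (verts H - R))"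
      unfolding obtainable_from_GO_def by blast
    have code: "OD_code (H \<restriction> (verts H - R)) D" using OD_code_of_GO[OF H] .
    \<comment> \<open>The code \<open>D\<close> lives in the subgraph of \<open>H\<close>, so the
      isomorphism has to be reversed to carry it to \<open>G\<close>.\<close>
    obtain hom where hom: "pre_digraph.digraph_isomorphism (H \<restriction> (verts H - R)) hom"
        "G = app_iso hom (H \<restriction> (verts H - R))"
      using digraph_iso_swap[OF wf_digraph iso] by (auto simp: digraph_iso_def)
    have "OD_code G (iso_verts hom ` D)"
      using OD_code_app_iso[OF hom(1) code] hom(2) by simp
    then have "OD_number G \<le> card (iso_verts hom ` D)" by (rule OD_number_le)
    also have "\<dots> = k"
      using card_iso_verts_image[OF hom(1)] code H(1) by (simp add: OD_code_iff GO_def)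
    finally show "OD_number G = k" using k_le by simp
  qed
qed

end
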